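(* Let $\mathbb F$ be a field of characteristic $p>3$ and let $\mathcal H$ be the Heisenberg algebra with basis $x,y,z$ and $[x,y]=z$. Then $\dim_{\mathbb F}H^2_*(\mathcal H,0)=8$ and $\dim_{\mathbb F}H^2_*(\mathcal H,x^* )=\dim_{\mathbb F}H^2_*(\mathcal H,z^* )=4$. Moreover (writing only the non-zero values on basis elements, and identifying cocycles with their classes): (i) a basis of $H^2_*(\mathcal H,0)$ is $\{(\varphi_1,0),(\varphi_2,0),(\varphi_3,0),(\varphi_4,0),(\varphi_5,0),(0,\omega_1),(0,\omega_2),(0,\omega_3)\}$ with $\varphi_1(x,z)=z$; $\varphi_2(y,z)=z$; $\varphi_3(x,z)=x,\ \varphi_3(y,z)=-y$; $\varphi_4(x,z)=y$; $\varphi_5(y,z)=x$; $\omega_1(x)=z$; $\omega_2(y)=z$; $\omega_3(z)=z$; (ii) a basis of $H^2_*(\mathcal H,x^* )$ is $\{(\varphi_1,0),(\varphi_2,0),(0,\omega_1),(0,\omega_2)\}$ with $\varphi_1(x,y)=x$; $\varphi_2(x,y)=y$; $\omega_1(y)=z$; $\omega_2(z)=z$; (iii) a basis of $H^2_*(\mathcal H,z^* )$ is $\{(\varphi_1,0),(\varphi_2,0),(0,\omega_1),(0,\omega_2)\}$ with $\varphi_1(x,y)=x$; $\varphi_2(x,y)=y$; $\omega_1(y)=z$; $\omega_2(x)=z$.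
   Context: For a linear form $\theta$ on $\mathcal H$, $(\mathcal H,\theta)$ is the restricted Lie algebra $\mathcal H$ ($z$ central) with $p$-map $(\alpha x+\beta y+\gamma z)^{[p]}=(\alpha^p\theta(x)+\beta^p\theta(y)+\gamma^p\theta(z))z$; $x^*,y^*,z^*$ is the dual basis. $H^2_*(\mathcal H,\theta)=Z^2_*/B^2_*$ is the second restricted cohomology group of $L=(\mathcal H,\theta)$ with coefficients in the adjoint module, defined as follows. For a restricted Lie algebra $L$ in characteristic $p>2$ acting on itself by $y\cdot x=[y,x]$, $C^2_*(L,L)$ is the space of pairs $(\varphi,\omega)$ with $\varphi:L\times L\to L$ alternating bilinear and $\omega:L\to L$ such that $\omega(\lambda x)=\lambda^p\omega(x)$ and $$\omega(x+y)=\omega(x)+\omega(y)+\sum_{x_i\in\{x,y\},\,x_1=x,\,x_2=y}\frac1{\sharp\{x\}}\sum_{k=0}^{p-2}(-1)^kx_p\cdots x_{p-k+1}\varphi([[\cdots[x_1,x_2],x_3]\cdots,x_{p-k-1}],x_{p-k})$$ (sum over sequences $(x_1,\dots,x_p)$; $\sharp\{x\}$ = number of $x_i$ equal to $x$; $x_p\cdots x_{p-k+1}$ is iterated action). For $L=(\mathcal H,\theta)$ and $p>3$ the double sum vanishes, so $\omega$ is any $p$-semilinear map (additive with $\omega(\lambda u)=\lambda^p\omega(u)$) and is determined by its values on $x,y,z$. $Z^2_*$ is the set of $(\varphi,\omega)\in C^2_*(L,L)$ with $$\varphi([x,y],z)-\varphi([x,z],y)+\varphi([y,z],x)-[x,\varphi(y,z)]+[y,\varphi(x,z)]-[z,\varphi(x,y)]=0$$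 and $\mathrm{ind}^2(\varphi,\omega)=0$, where $$\mathrm{ind}^2(\varphi,\omega)(x,y)=\varphi(x,y^{[p]})-\sum_{i+j=p-1}(-1)^iy^i\cdot\varphi([\cdots[x,\underbrace{y],\cdots,y}_{j}],y)+[x,\omega(y)].$$ $B^2_*$ is the set of pairs $(d^1_{CE}\psi,\mathrm{ind}^1\psi)$, $\psi:L\to L$ linear, with $d^1_{CE}\psi(x,y)=\psi([x,y])-[x,\psi(y)]+[y,\psi(x)]$ and $\mathrm{ind}^1(\psi)(x)=\psi(x^{[p]})-\mathrm{ad}_x^{p-1}(\psi(x))$. In these general formulas $x,y,z$ denote arbitrary elements of $L$. *)

theory Defs
  imports
    "HOL-Analysis.Cartesian_Space"
    "HOL-Library.Function_Algebras"
    "HOL-Library.Product_Plus"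
    "HOL-Library.Set_Algebras"
    "HOL-Computational_Algebra.Primes"
begin

section \<open>Quotients of subspaces\<close>

text \<open>
  The quotient \<open>Z / B\<close> consists of cosets; its zero is \<open>B\<close> and its addition is the
  elementwise sum of sets. Adding \<open>B\<close> in the scalar multiplication only matters for
  the scalar \<open>0\<close>, and in linear combinations only for the empty one (an empty sum of sets is
  \<open>{0}\<close>, not \<open>B\<close>).
\<close>

definition quotient_space :: "'v::ab_group_add set \<Rightarrow> 'v set \<Rightarrow> 'v set set"
  where "quotient_space Z B = (\<lambda>v. v +o B) ` Z"

definition coset_scale ::
    "('a::field \<Rightarrow> 'v::ab_group_add \<Rightarrow> 'v) \<Rightarrow> 'v set \<Rightarrow> 'a \<Rightarrow> 'v set \<Rightarrow> 'v set"
  where "coset_scale s B r C = s r ` C + B"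

definition coset_comb ::
    "('a::field \<Rightarrow> 'v::ab_group_add \<Rightarrow> 'v) \<Rightarrow> 'v set \<Rightarrow> 'v set set \<Rightarrow> ('v set \<Rightarrow> 'a) \<Rightarrow> 'v set"
  where "coset_comb s B T r = B + (\<Sum>C\<in>T. coset_scale s B (r C) C)"

definition quotient_independent ::
    "('a::field \<Rightarrow> 'v::ab_group_add \<Rightarrow> 'v) \<Rightarrow> 'v set \<Rightarrow> 'v set set \<Rightarrow> bool"
  where "quotient_independent s B S \<longleftrightarrow>
    (\<forall>T r. finite T \<and> T \<subseteq> S \<and> coset_comb s B T r = B \<longrightarrow> (\<forall>C\<in>T. r C = 0))"

definition quotient_span ::
    "('a::field \<Rightarrow> 'v::ab_group_add \<Rightarrow> 'v) \<Rightarrow> 'v set \<Rightarrow> 'v set set \<Rightarrow> 'v set set"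
  where "quotient_span s B S = {coset_comb s B T r | T r. finite T \<and> T \<subseteq> S}"

definition quotient_basis ::
    "('a::field \<Rightarrow> 'v::ab_group_add \<Rightarrow> 'v) \<Rightarrow> 'v set \<Rightarrow> 'v set \<Rightarrow> 'v set set \<Rightarrow> bool"
  where "quotient_basis s Z B S \<longleftrightarrow>
    S \<subseteq> quotient_space Z B \<and> quotient_independent s B S \<and>
    quotient_span s B S = quotient_space Z B"

text \<open>As for \<^const>\<open>vector_space.dim\<close>, an infinite-dimensional quotient gets dimension \<open>0\<close>.\<close>

definition quotient_dim ::
    "('a::field \<Rightarrow> 'v::ab_group_add \<Rightarrow> 'v) \<Rightarrow> 'v set \<Rightarrow> 'v set \<Rightarrow> nat"
  where "quotient_dim s Z B = card (SOME S. quotient_basis s Z B S)"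

lemma coset_add:
  assumes "vector_space s" and "module.subspace s B"
  shows "(v +o B) + (w +o B) = (v + w) +o B"
proof -
  interpret vector_space s by fact
  have "B + B = B"
  proof
    show "B + B \<subseteq> B"
      using subspace_add[OF assms(2)] by (auto simp: set_plus_def)
    show "B \<subseteq> B + B"
      using subspace_0[OF assms(2)] by (force simp: set_plus_def)
  qed
  then show ?thesis
    by (simp add: set_plus_rearrange)
qed

lemma coset_scale_coset:
  assumes "vector_space s" and "module.subspace s B"
  shows "coset_scale s B r (v +o B) = s r v +o B"
proof -
  interpret vector_space s by fact
  show ?thesis
  proof
    show "coset_scale s B r (v +o B) \<subseteq> s r v +o B"
    proof
      fix u assume "u \<in> coset_scale s B r (v +o B)"
      then obtain b c where "b \<in> B" "c \<in> B" "u = s r (v + b) + c"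
        unfolding coset_scale_def set_plus_def elt_set_plus_def by blast
      then have "u = s r v + (s r b + c)" "s r b + c \<in> B"
        using subspace_add[OF assms(2)] subspace_scale[OF assms(2)]
        by (auto simp: scale_right_distrib add.assoc)
      then show "u \<in> s r v +o B"
        unfolding elt_set_plus_def by blast
    qed
    show "s r v +o B \<subseteq> coset_scale s B r (v +o B)"
    proof
      fix u assume "u \<in> s r v +o B"
      then obtain b where b: "b \<in> B" "u = s r v + b"
        unfolding elt_set_plus_def by blast
      have "v \<in> v +o B"
        using subspace_0[OF assms(2)] unfolding elt_set_plus_def by force
      then show "u \<in> coset_scale s B r (v +o B)"
        using b unfolding coset_scale_def set_plus_def by blast
    qed
  qed
qed


section \<open>Restricted Lie algebras and their restricted cohomology\<close>

text \<open>
  A sequence \<open>x\<^sub>1, \<dots>, x\<^sub>p\<close> of symbols \<open>x\<close>, \<open>y\<close> with \<open>x\<^sub>1 = x\<close> and \<open>x\<^sub>2 = y\<close> is a word of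
  booleans, \<open>True\<close> standing for \<open>x\<close>. The symbols are formal, so that \<open>\<sharp>{x}\<close> is
  also meaningful if \<open>x\<close> and \<open>y\<close> happen to be equal as elements. List positions start at \<open>0\<close>,
  hence \<open>x\<^sub>i\<close> is \<open>xs ! (i - 1)\<close>.
\<close>

definition xy_words :: "nat \<Rightarrow> bool list set"
  where "xy_words p = {w. length w = p \<and> w ! 0 = True \<and> w ! 1 = False}"

definition xy_seq :: "'v \<Rightarrow> 'v \<Rightarrow> bool list \<Rightarrow> 'v list"
  where "xy_seq x y w = map (\<lambda>b. if b then x else y) w"

text \<open>The left-normed bracket \<open>[[\<cdots>[x\<^sub>1, x\<^sub>2], \<cdots>], x\<^sub>m]\<close>.\<close>

definition left_normed :: "('v \<Rightarrow> 'v \<Rightarrow> 'v) \<Rightarrow> 'v list \<Rightarrow> 'v"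
  where "left_normed br xs = foldl br (hd xs) (tl xs)"

text \<open>
  The characteristic \<open>p\<close> is \<open>CHAR('a)\<close>. In \<open>pmap_add\<close>, the sum is Jacobson's
  \<open>\<Sum> s\<^sub>i(x, y)\<close>, where \<open>i s\<^sub>i(x, y)\<close> is the coefficient of \<open>t\<^sup>i\<^sup>-\<^sup>1\<close> in \<open>(ad (t x + y))\<^sup>p\<^sup>-\<^sup>1 (x)\<close>,
  written out over words (\<open>p - 1\<close> is even, so that reversing all brackets does not
  change the sign).
\<close>

locale restricted_lie_algebra = vector_space scale
  for scale :: "'a::field \<Rightarrow> 'v::ab_group_add \<Rightarrow> 'v" +
  fixes bracket :: "'v \<Rightarrow> 'v \<Rightarrow> 'v"
    and pmap :: "'v \<Rightarrow> 'v"
  assumes char_gt_2: "CHAR('a) > 2"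
    and bracket_linear_left: "Vector_Spaces.linear scale scale (\<lambda>u. bracket u v)"
    and bracket_linear_right: "Vector_Spaces.linear scale scale (\<lambda>v. bracket u v)"
    and bracket_self: "bracket u u = 0"
    and jacobi: "bracket (bracket u v) w + bracket (bracket v w) u + bracket (bracket w u) v = 0"
    and pmap_scale: "pmap (scale r u) = scale (r ^ CHAR('a)) (pmap u)"
    and bracket_pmap: "bracket (pmap u) v = (bracket u ^^ CHAR('a)) v"
    and pmap_add: "pmap (x + y) = pmap x + pmap y +
      (\<Sum>w\<in>xy_words CHAR('a). scale (1 / of_nat (count_list w True))
        (left_normed bracket (xy_seq x y w)))"
begin

definition alternating_bilinear :: "('v \<Rightarrow> 'v \<Rightarrow> 'v) \<Rightarrow> bool"
  where "alternating_bilinear \<phi> \<longleftrightarrow>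
    (\<forall>v. Vector_Spaces.linear scale scale (\<lambda>u. \<phi> u v)) \<and>
    (\<forall>u. Vector_Spaces.linear scale scale (\<lambda>v. \<phi> u v)) \<and>
    (\<forall>u. \<phi> u u = 0)"

text \<open>
  The double sum: with \<open>xs = [x\<^sub>1, \<dots>, x\<^sub>p]\<close>, the inner summand is
  \<open>x\<^sub>p \<cdots> x\<^sub>p\<^sub>-\<^sub>k\<^sub>+\<^sub>1 \<phi>([[\<cdots>[x\<^sub>1, x\<^sub>2], \<cdots>], x\<^sub>p\<^sub>-\<^sub>k\<^sub>-\<^sub>1], x\<^sub>p\<^sub>-\<^sub>k)\<close>, with \<open>x\<^sub>p\<^sub>-\<^sub>k\<^sub>+\<^sub>1\<close> acting first.
\<close>

definition star_sum :: "('v \<Rightarrow> 'v \<Rightarrow> 'v) \<Rightarrow> 'v \<Rightarrow> 'v \<Rightarrow> 'v"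
  where "star_sum \<phi> x y =
    (let p = CHAR('a) in
      \<Sum>w\<in>xy_words p.
        let xs = xy_seq x y w in
        scale (1 / of_nat (count_list w True))
          (\<Sum>k = 0..p - 2. scale ((-1) ^ k)
            (foldl (\<lambda>v u. bracket u v)
              (\<phi> (left_normed bracket (take (p - k - 1) xs)) (xs ! (p - k - 1)))
              (drop (p - k) xs))))"

definition C2 :: "(('v \<Rightarrow> 'v \<Rightarrow> 'v) \<times> ('v \<Rightarrow> 'v)) set"
  where "C2 = {(\<phi>, \<omega>). alternating_bilinear \<phi> \<and>
    (\<forall>r x. \<omega> (scale r x) = scale (r ^ CHAR('a)) (\<omega> x)) \<and>
    (\<forall>x y. \<omega> (x + y) = \<omega> x + \<omega> y + star_sum \<phi> x y)}"

definition d2_CE :: "('v \<Rightarrow> 'v \<Rightarrow> 'v) \<Rightarrow> 'v \<Rightarrow> 'v \<Rightarrow> 'v \<Rightarrow> 'v"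
  where "d2_CE \<phi> x y z =
    \<phi> (bracket x y) z - \<phi> (bracket x z) y + \<phi> (bracket y z) x
    - bracket x (\<phi> y z) + bracket y (\<phi> x z) - bracket z (\<phi> x y)"

definition ind2 :: "('v \<Rightarrow> 'v \<Rightarrow> 'v) \<Rightarrow> ('v \<Rightarrow> 'v) \<Rightarrow> 'v \<Rightarrow> 'v \<Rightarrow> 'v"
  where "ind2 \<phi> \<omega> x y =
    \<phi> x (pmap y)
    - (\<Sum>(i, j) \<in> {(i, j). i + j = CHAR('a) - 1}.
        scale ((-1) ^ i) ((bracket y ^^ i) (\<phi> (((\<lambda>u. bracket u y) ^^ j) x) y)))
    + bracket x (\<omega> y)"

definition Z2 :: "(('v \<Rightarrow> 'v \<Rightarrow> 'v) \<times> ('v \<Rightarrow> 'v)) set"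
  where "Z2 = {(\<phi>, \<omega>) \<in> C2.
    (\<forall>x y z. d2_CE \<phi> x y z = 0) \<and> (\<forall>x y. ind2 \<phi> \<omega> x y = 0)}"

definition d1_CE :: "('v \<Rightarrow> 'v) \<Rightarrow> 'v \<Rightarrow> 'v \<Rightarrow> 'v"
  where "d1_CE \<psi> x y = \<psi> (bracket x y) - bracket x (\<psi> y) + bracket y (\<psi> x)"

definition ind1 :: "('v \<Rightarrow> 'v) \<Rightarrow> 'v \<Rightarrow> 'v"
  where "ind1 \<psi> x = \<psi> (pmap x) - (bracket x ^^ (CHAR('a) - 1)) (\<psi> x)"

definition B2 :: "(('v \<Rightarrow> 'v \<Rightarrow> 'v) \<times> ('v \<Rightarrow> 'v)) set"
  where "B2 = {(d1_CE \<psi>, ind1 \<psi>) | \<psi>. Vector_Spaces.linear scale scale \<psi>}"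

definition pair_scale ::
    "'a \<Rightarrow> ('v \<Rightarrow> 'v \<Rightarrow> 'v) \<times> ('v \<Rightarrow> 'v) \<Rightarrow> ('v \<Rightarrow> 'v \<Rightarrow> 'v) \<times> ('v \<Rightarrow> 'v)"
  where "pair_scale r c = ((\<lambda>u v. scale r (fst c u v)), (\<lambda>u. scale r (snd c u)))"

sublocale pair: vector_space pair_scale
  by unfold_locales
    (auto simp: pair_scale_def fun_eq_iff prod_eq_iff scale_right_distrib scale_left_distrib)

definition H2 :: "(('v \<Rightarrow> 'v \<Rightarrow> 'v) \<times> ('v \<Rightarrow> 'v)) set set"
  where "H2 = quotient_space Z2 B2"

definition H2_class ::
    "('v \<Rightarrow> 'v \<Rightarrow> 'v) \<times> ('v \<Rightarrow> 'v) \<Rightarrow> (('v \<Rightarrow> 'v \<Rightarrow> 'v) \<times> ('v \<Rightarrow> 'v)) set"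
  where "H2_class c = c +o B2"

definition H2_basis :: "(('v \<Rightarrow> 'v \<Rightarrow> 'v) \<times> ('v \<Rightarrow> 'v)) set set \<Rightarrow> bool"
  where "H2_basis S \<longleftrightarrow> quotient_basis pair_scale Z2 B2 S"

definition H2_dim :: nat
  where "H2_dim = quotient_dim pair_scale Z2 B2"

end


section \<open>The Heisenberg algebra\<close>

definition hx :: "'a::field ^ 3" where "hx = axis 1 1"
definition hy :: "'a::field ^ 3" where "hy = axis 2 1"
definition hz :: "'a::field ^ 3" where "hz = axis 3 1"

definition heis_bracket :: "'a::field ^ 3 \<Rightarrow> 'a ^ 3 \<Rightarrow> 'a ^ 3"
  where "heis_bracket u v = (u $ 1 * v $ 2 - u $ 2 * v $ 1) *s hz"

definition heis_pmap :: "('a::field ^ 3 \<Rightarrow> 'a) \<Rightarrow> 'a ^ 3 \<Rightarrow> 'a ^ 3"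
  where "heis_pmap \<theta> u =
    ((u $ 1) ^ CHAR('a) * \<theta> hx + (u $ 2) ^ CHAR('a) * \<theta> hy + (u $ 3) ^ CHAR('a) * \<theta> hz) *s hz"

definition x_dual :: "'a::field ^ 3 \<Rightarrow> 'a" where "x_dual u = u $ 1"
definition z_dual :: "'a::field ^ 3 \<Rightarrow> 'a" where "z_dual u = u $ 3"

text \<open>
  The alternating bilinear map with the values \<open>a\<close>, \<open>b\<close>, \<open>c\<close> at
  \<open>(x, y)\<close>, \<open>(x, z)\<close>, \<open>(y, z)\<close>, and the \<open>p\<close>-semilinear map with the values \<open>a\<close>, \<open>b\<close>, \<open>c\<close>
  at \<open>x\<close>, \<open>y\<close>, \<open>z\<close>.
\<close>

definition heis_alt :: "'a::field ^ 3 \<Rightarrow> 'a ^ 3 \<Rightarrow> 'a ^ 3 \<Rightarrow> 'a ^ 3 \<Rightarrow> 'a ^ 3 \<Rightarrow> 'a ^ 3"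
  where "heis_alt a b c u v =
    (u $ 1 * v $ 2 - u $ 2 * v $ 1) *s a +
    (u $ 1 * v $ 3 - u $ 3 * v $ 1) *s b +
    (u $ 2 * v $ 3 - u $ 3 * v $ 2) *s c"

definition heis_semi :: "'a::field ^ 3 \<Rightarrow> 'a ^ 3 \<Rightarrow> 'a ^ 3 \<Rightarrow> 'a ^ 3 \<Rightarrow> 'a ^ 3"
  where "heis_semi a b c u =
    ((u $ 1) ^ CHAR('a)) *s a + ((u $ 2) ^ CHAR('a)) *s b + ((u $ 3) ^ CHAR('a)) *s c"

abbreviation heis_H2_dim :: "('a::field ^ 3 \<Rightarrow> 'a) \<Rightarrow> nat"
  where "heis_H2_dim \<theta> \<equiv> restricted_lie_algebra.H2_dim (*s) heis_bracket (heis_pmap \<theta>)"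

abbreviation heis_H2_basis ::
    "('a::field ^ 3 \<Rightarrow> 'a) \<Rightarrow> (('a ^ 3 \<Rightarrow> 'a ^ 3 \<Rightarrow> 'a ^ 3) \<times> ('a ^ 3 \<Rightarrow> 'a ^ 3)) set set \<Rightarrow> bool"
  where "heis_H2_basis \<theta> \<equiv> restricted_lie_algebra.H2_basis (*s) heis_bracket (heis_pmap \<theta>)"

abbreviation heis_H2_class ::
    "('a::field ^ 3 \<Rightarrow> 'a) \<Rightarrow> ('a ^ 3 \<Rightarrow> 'a ^ 3 \<Rightarrow> 'a ^ 3) \<times> ('a ^ 3 \<Rightarrow> 'a ^ 3) \<Rightarrow>
      (('a ^ 3 \<Rightarrow> 'a ^ 3 \<Rightarrow> 'a ^ 3) \<times> ('a ^ 3 \<Rightarrow> 'a ^ 3)) set"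
  where "heis_H2_class \<theta> \<equiv> restricted_lie_algebra.H2_class (*s) heis_bracket (heis_pmap \<theta>)"

lemma heis_comp [simp]:
  "hx $ 1 = 1" "hx $ 2 = 0" "hx $ 3 = 0"
  "hy $ 1 = 0" "hy $ 2 = 1" "hy $ 3 = 0"
  "hz $ 1 = 0" "hz $ 2 = 0" "hz $ 3 = 1"
  by (simp_all add: hx_def hy_def hz_def axis_def)

lemma heis_decomp: "u = (u $ 1) *s hx + (u $ 2) *s hy + (u $ 3) *s hz"
  by (simp add: vec_eq_iff forall_3)

lemma heis_bracket_basis:
  "heis_bracket hx hy = hz" "heis_bracket hx hz = 0" "heis_bracket hy hz = 0"
  by (simp_all add: heis_bracket_def)

lemma heis_bracket_bracket [simp]:
  "heis_bracket (heis_bracket u v) w = 0" "heis_bracket w (heis_bracket u v) = 0"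
  by (simp_all add: heis_bracket_def)

lemma heis_bracket_zero [simp]: "heis_bracket 0 v = 0" "heis_bracket v 0 = 0"
  by (simp_all add: heis_bracket_def)

lemma heis_bracket_iterate:
  assumes "n \<ge> 2"
  shows "(heis_bracket u ^^ n) v = 0" "((\<lambda>w. heis_bracket w u) ^^ n) v = 0"
proof -
  have *: "(heis_bracket u ^^ Suc (Suc k)) v = 0 \<and> ((\<lambda>w. heis_bracket w u) ^^ Suc (Suc k)) v = 0" for k
    by (induction k) auto
  obtain k where "n = Suc (Suc k)"
    using assms by (metis add_2_eq_Suc le_Suc_ex)
  with * show "(heis_bracket u ^^ n) v = 0" "((\<lambda>w. heis_bracket w u) ^^ n) v = 0"
    by auto
qed

lemma heis_foldl_zero: "foldl heis_bracket 0 xs = 0"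
  by (induction xs) auto

lemma heis_foldl_zero': "foldl (\<lambda>v u. heis_bracket u v) 0 xs = 0"
  by (induction xs) auto

lemma heis_left_normed:
  assumes "length xs \<ge> 3"
  shows "left_normed heis_bracket xs = 0"
proof -
  obtain a b c ys where "xs = a # b # c # ys"
    using assms by (auto simp: numeral_3_eq_3 Suc_le_length_iff)
  then show ?thesis
    by (simp add: left_normed_def heis_foldl_zero)
qed

lemma heis_restricted_lie_algebra:
  fixes \<theta> :: "'a::field ^ 3 \<Rightarrow> 'a"
  assumes "CHAR('a) > 3"
  shows "restricted_lie_algebra (*s) heis_bracket (heis_pmap \<theta>)"
proof
  have prime: "prime CHAR('a)"
    using assms by (intro prime_CHAR_semidom) auto
  show "CHAR('a) > 2"
    using assms by simp
  show "heis_bracket (heis_pmap \<theta> u) v = (heis_bracket u ^^ CHAR('a)) v" for u v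
    using assms by (simp add: heis_bracket_iterate) (simp add: heis_bracket_def heis_pmap_def)
  have "(\<Sum>w\<in>xy_words CHAR('a). (1 / of_nat (count_list w True)) *s
      left_normed heis_bracket (xy_seq x y w)) = 0" for x y :: "'a ^ 3"
    using assms
    by (intro sum.neutral) (auto simp: xy_words_def xy_seq_def heis_left_normed)
  then show "heis_pmap \<theta> (x + y) = heis_pmap \<theta> x + heis_pmap \<theta> y +
      (\<Sum>w\<in>xy_words CHAR('a). (1 / of_nat (count_list w True)) *s
        left_normed heis_bracket (xy_seq x y w))" for x y
    by (simp add: heis_pmap_def freshmans_dream[OF prime] vec_eq_iff algebra_simps)
qed (auto simp: heis_bracket_def heis_pmap_def vec_eq_iff algebra_simps power_mult_distrib)

text \<open>
  Alternating bilinear maps, and \<open>p\<close>-semilinear maps, on the Heisenberg algebra are determined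
  by their values on basis elements; for \<open>p > 3\<close> the \<open>\<omega>\<close>-components of cochains are
  precisely the \<open>p\<close>-semilinear maps.
\<close>

lemma heis_alt_alternating_bilinear:
  fixes a b c :: "'a::field ^ 3"
  assumes "CHAR('a) > 3"
  shows "restricted_lie_algebra.alternating_bilinear (*s) (heis_alt a b c)"
proof -
  interpret restricted_lie_algebra "(*s)" heis_bracket "heis_pmap (\<lambda>_ :: 'a ^ 3. 0)"
    by (rule heis_restricted_lie_algebra) fact
  show ?thesis
    unfolding alternating_bilinear_def
    by (auto simp: Vector_Spaces.linear_iff heis_alt_def vec_eq_iff algebra_simps
        vec.vector_space_axioms)
qed

lemma heis_alternating_bilinear_eq:
  fixes \<phi> :: "'a::field ^ 3 \<Rightarrow> 'a ^ 3 \<Rightarrow> 'a ^ 3"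
  assumes "CHAR('a) > 3"
    and "restricted_lie_algebra.alternating_bilinear (*s) \<phi>"
  shows "\<phi> = heis_alt (\<phi> hx hy) (\<phi> hx hz) (\<phi> hy hz)"
proof (intro ext)
  fix u v :: "'a ^ 3"
  interpret restricted_lie_algebra "(*s)" heis_bracket "heis_pmap (\<lambda>_ :: 'a ^ 3. 0)"
    by (rule heis_restricted_lie_algebra) fact
  have add: "\<phi> (a + b) c = \<phi> a c + \<phi> b c" "\<phi> c (a + b) = \<phi> c a + \<phi> c b"
    and scale: "\<phi> (r *s a) c = r *s \<phi> a c" "\<phi> c (r *s a) = r *s \<phi> c a"
    and self: "\<phi> a a = 0" for a b c r
    using assms(2) unfolding alternating_bilinear_def Vector_Spaces.linear_iff by auto
  have skew: "\<phi> a b = - \<phi> b a" for a b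
    using self[of "a + b"] unfolding add by (simp add: self eq_neg_iff_add_eq_0 add.commute)
  have "\<phi> u v = \<phi> ((u $ 1) *s hx + (u $ 2) *s hy + (u $ 3) *s hz)
      ((v $ 1) *s hx + (v $ 2) *s hy + (v $ 3) *s hz)"
    by (simp flip: heis_decomp)
  then show "\<phi> u v = heis_alt (\<phi> hx hy) (\<phi> hx hz) (\<phi> hy hz) u v"
    unfolding heis_alt_def add scale self skew[of hy hx] skew[of hz hx] skew[of hz hy]
    by (simp add: vec_eq_iff algebra_simps)
qed

lemma heis_star_sum:
  fixes \<phi> :: "'a::field ^ 3 \<Rightarrow> 'a ^ 3 \<Rightarrow> 'a ^ 3"
  assumes "CHAR('a) > 3"
    and "restricted_lie_algebra.alternating_bilinear (*s) \<phi>"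
  shows "restricted_lie_algebra.star_sum (*s) heis_bracket \<phi> u v = 0"
proof -
  interpret restricted_lie_algebra "(*s)" heis_bracket "heis_pmap (\<lambda>_ :: 'a ^ 3. 0)"
    by (rule heis_restricted_lie_algebra) fact
  have prime: "prime CHAR('a)"
    using assms(1) by (intro prime_CHAR_semidom) auto
  have "CHAR('a) \<noteq> 4"
    using prime prime_odd_nat[of "CHAR('a)"] by auto
  then have p: "CHAR('a) \<ge> 5"
    using assms(1) by simp
  have "\<phi> (0 *s a) b = 0 *s \<phi> a b" for a b
    using assms(2) unfolding alternating_bilinear_def Vector_Spaces.linear_iff by blast
  then have zero: "\<phi> 0 b = 0" for b
    by simp
  have act: "foldl (\<lambda>v u. heis_bracket u v) a ys = 0" if len: "length ys \<ge> 2" for a and ys :: "('a ^ 3) list"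
  proof -
    obtain b c zs where "ys = b # c # zs"
      using len by (cases ys; cases "tl ys") auto
    then show ?thesis
      by (simp add: heis_foldl_zero')
  qed
  have "foldl (\<lambda>v u. heis_bracket u v)
      (\<phi> (left_normed heis_bracket (take (CHAR('a) - k - 1) xs)) (xs ! (CHAR('a) - k - 1)))
      (drop (CHAR('a) - k) xs) = 0"
    if "length xs = CHAR('a)" "k \<le> CHAR('a) - 2" for k and xs :: "('a ^ 3) list"
  proof (cases "k \<ge> 2")
    case True
    then show ?thesis
      using that p by (intro act) auto
  next
    case False
    then have "left_normed heis_bracket (take (CHAR('a) - k - 1) xs) = 0"
      using that p by (intro heis_left_normed) auto
    then show ?thesis
      by (simp add: zero heis_foldl_zero')
  qed
  then show ?thesis
    unfolding star_sum_def Let_def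
    by (intro sum.neutral ballI) (auto simp: xy_words_def xy_seq_def)
qed

lemma heis_semi_eq:
  fixes \<omega> :: "'a::field ^ 3 \<Rightarrow> 'a ^ 3"
  assumes "\<And>u v. \<omega> (u + v) = \<omega> u + \<omega> v" and "\<And>r u. \<omega> (r *s u) = (r ^ CHAR('a)) *s \<omega> u"
  shows "\<omega> = heis_semi (\<omega> hx) (\<omega> hy) (\<omega> hz)"
proof
  fix u
  have "\<omega> u = \<omega> ((u $ 1) *s hx + (u $ 2) *s hy + (u $ 3) *s hz)"
    by (simp flip: heis_decomp)
  then show "\<omega> u = heis_semi (\<omega> hx) (\<omega> hy) (\<omega> hz) u"
    by (simp only: assms heis_semi_def)
qed

lemma heis_C2:
  fixes \<theta> :: "'a::field ^ 3 \<Rightarrow> 'a"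
  assumes "CHAR('a) > 3"
  shows "restricted_lie_algebra.C2 (*s) heis_bracket =
    {(heis_alt a b c, heis_semi a' b' c') | a b c a' b' c' :: 'a ^ 3. True}"
proof -
  interpret restricted_lie_algebra "(*s)" heis_bracket "heis_pmap (\<lambda>_ :: 'a ^ 3. 0)"
    by (rule heis_restricted_lie_algebra) fact
  have prime: "prime CHAR('a)"
    using assms by (intro prime_CHAR_semidom) auto
  have "heis_semi a b c (u + v) = heis_semi a b c u + heis_semi a b c v"
    "heis_semi a b c (r *s u) = (r ^ CHAR('a)) *s heis_semi a b c u" for a b c u v :: "'a ^ 3" and r
    by (simp_all add: heis_semi_def freshmans_dream[OF prime] vec_eq_iff algebra_simps
        power_mult_distrib)
  moreover have "\<exists>a b c. \<phi> = heis_alt a b c" if "alternating_bilinear \<phi>" for \<phi>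
    using heis_alternating_bilinear_eq[OF assms that] by blast
  moreover have "\<exists>a b c. \<omega> = heis_semi a b c"
    if "\<And>u v. \<omega> (u + v) = \<omega> u + \<omega> v" "\<And>r u. \<omega> (r *s u) = (r ^ CHAR('a)) *s \<omega> u" for \<omega> :: "'a ^ 3 \<Rightarrow> 'a ^ 3"
    using heis_semi_eq[of \<omega>, OF that] by blast
  ultimately show ?thesis
    unfolding C2_def using heis_alt_alternating_bilinear[OF assms]
    by (auto simp: heis_star_sum[OF assms])
qed

end

theory Submission
  imports Defs
begin

text \<open>
  For \<open>p > 3\<close> all iterated brackets in the restricted differentials vanish, so a cochain is a
  sextuple of vectors (the values of \<open>\<phi>\<close> at \<open>(x, y)\<close>, \<open>(x, z)\<close>, \<open>(y, z)\<close> and of \<open>\<omega>\<close> at \<open>x\<close>, \<open>y\<close>,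
  \<open>z\<close>), and the cocycle and coboundary conditions are linear equations in the coordinates of
  these vectors. The dimension of a quotient is well defined because a linear map with kernel
  \<open>B\<close> carries every basis of \<open>Z / B\<close> to a basis of the image of \<open>Z\<close>.
\<close>

section \<open>Bases of quotients\<close>

lemma coset_eq_iff:
  assumes "vector_space s" and "module.subspace s B"
  shows "v +o B = w +o B \<longleftrightarrow> v - w \<in> B"
proof -
  interpret vector_space s by fact
  show ?thesis
  proof
    assume "v +o B = w +o B"
    moreover have "v \<in> v +o B"
      using subspace_0[OF assms(2)] unfolding elt_set_plus_def by force
    ultimately show "v - w \<in> B"
      unfolding elt_set_plus_def by auto
  next
    assume d: "v - w \<in> B"
    have "u - v \<in> B \<longleftrightarrow> u - w \<in> B" for u
      using subspace_add[OF assms(2), of "u - v" "v - w"]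
        subspace_diff[OF assms(2), of "u - w" "v - w"] d by auto
    moreover have "u \<in> t +o B \<longleftrightarrow> u - t \<in> B" for u t
      unfolding elt_set_plus_def by (auto intro: bexI[of _ "u - t"])
    ultimately show "v +o B = w +o B"
      by blast
  qed
qed

lemma coset_eq_iff_mem:
  assumes "vector_space s" and "module.subspace s B"
  shows "v +o B = B \<longleftrightarrow> v \<in> B"
  using coset_eq_iff[OF assms, of v 0] by (simp add: set_zero_plus)

text \<open>Combinations of cosets are computed on representatives. As \<open>coset_comb\<close>
  sums over a set of cosets, \<open>F\<close> must be injective for the sum to be reindexed by
  \<open>I\<close>.\<close>

lemma coset_comb_image:
  assumes "vector_space s" and "module.subspace s B"
    and "finite I" and "inj_on F I" and "\<And>i. i \<in> I \<Longrightarrow> F i = v i +o B"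
  shows "coset_comb s B (F ` I) r = (\<Sum>i\<in>I. s (r (F i)) (v i)) +o B"
proof -
  \<comment> \<open>The summand \<open>B\<close> is carried through the induction because the empty
    sum of sets is \<open>{0}\<close>, while the coset of the empty sum of vectors is
    \<open>B\<close>.\<close>
  have "B + (\<Sum>i\<in>I. w i +o B) = (\<Sum>i\<in>I. w i) +o B" for w
    using assms(3)
  proof induction
    case empty
    then show ?case by (simp add: set_zero_plus)
  next
    case (insert i I)
    have "B + ((w i +o B) + (\<Sum>i\<in>I. w i +o B)) = (w i +o B) + (B + (\<Sum>i\<in>I. w i +o B))"
      by (simp add: add.left_commute)
    then show ?case
      using insert by (simp add: coset_add[OF assms(1,2)])
  qed
  then have "(\<Sum>i\<in>I. s (r (F i)) (v i)) +o B = B + (\<Sum>i\<in>I. s (r (F i)) (v i) +o B)"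
    by metis
  also have "(\<Sum>i\<in>I. s (r (F i)) (v i) +o B) = (\<Sum>i\<in>I. coset_scale s B (r (F i)) (F i))"
    by (intro sum.cong) (simp_all add: assms(5) coset_scale_coset[OF assms(1,2)])
  finally show ?thesis
    by (simp add: coset_comb_def sum.reindex[OF assms(4)])
qed

text \<open>A basis \<open>b\<close> of \<open>B\<close> is extended to a basis \<open>E\<close> of
  the whole space; the projection that kills \<open>b\<close> and fixes the rest of \<open>E\<close>
  has kernel \<open>B\<close>. It serves as a vector-valued model of the quotient map.\<close>

lemma exists_linear_kernel_eq:
  assumes "vector_space s" and "module.subspace s B"
  obtains \<pi> where "Vector_Spaces.linear s s \<pi>" and "\<And>v. \<pi> v = 0 \<longleftrightarrow> v \<in> B"
proof -
  interpret vector_space s by fact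
  interpret pr: vector_space_pair s s by unfold_locales
  obtain b where b: "b \<subseteq> B" "independent b" "B \<subseteq> span b"
    by (meson basis_exists)
  define E where "E = extend_basis b"
  define \<pi> where "\<pi> = pr.construct E (\<lambda>v. if v \<in> b then 0 else v)"
  have E: "independent E" "b \<subseteq> E" "span E = UNIV"
    using b(2) by (simp_all add: E_def independent_extend_basis extend_basis_superset)
  have lin: "Vector_Spaces.linear s s \<pi>"
    unfolding \<pi>_def by (rule pr.linear_construct) fact
  interpret lp: Vector_Spaces.linear s s \<pi> by fact
  have \<pi>: "\<pi> v = (if v \<in> b then 0 else v)" if "v \<in> E" for v
    unfolding \<pi>_def using that by (rule pr.construct_basis[OF E(1)])
  have "\<pi> v = 0" if "v \<in> B" for v
    by (rule pr.linear_eq_0_on_span[OF lin, of b]) (use \<pi> E(2) b(3) that in auto)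
  \<comment> \<open>For \<open>v\<close> in \<open>E\<close> the difference is \<open>v\<close>
    itself if \<open>v\<close> lies in \<open>b\<close>, and 0 otherwise; linearity extends this to
    all \<open>v\<close>. It yields the inclusion of the kernel in \<open>B\<close>.\<close>
  moreover have diff: "v - \<pi> v \<in> B" for v
  proof -
    have "subspace {v. v - \<pi> v \<in> B}"
      unfolding subspace_def
      using subspace_0[OF assms(2)] subspace_add[OF assms(2)] subspace_scale[OF assms(2)]
      by (auto simp: lp.zero lp.add lp.scale add_diff_add simp flip: scale_right_diff_distrib)
    moreover have "E \<subseteq> {v. v - \<pi> v \<in> B}"
      using \<pi> b(1) subspace_0[OF assms(2)] by auto
    ultimately have "span E \<subseteq> {v. v - \<pi> v \<in> B}"
      by (rule span_minimal[rotated])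
    then show ?thesis
      using E(3) by auto
  qed
  moreover have "v \<in> B" if "\<pi> v = 0" for v
    using diff[of v] that by simp
  ultimately show thesis
    using that lin by blast
qed

lemma card_quotient_basis:
  assumes "vector_space s" and B: "module.subspace s B"
    and lin: "Vector_Spaces.linear s s \<pi>" and ker: "\<And>v. \<pi> v = 0 \<longleftrightarrow> v \<in> B"
    and S: "quotient_basis s Z B S"
  shows "card S = vector_space.dim s (\<pi> ` Z)"
proof -
  interpret vector_space s by fact
  interpret lp: Vector_Spaces.linear s s \<pi> by fact
  note coset_eq = coset_eq_iff[OF assms(1) B] and coset_mem = coset_eq_iff_mem[OF assms(1) B]
  have "\<forall>C\<in>S. \<exists>v\<in>Z. C = v +o B"
    using S by (auto simp: quotient_basis_def quotient_space_def)
  then obtain g where g: "\<And>C. C \<in> S \<Longrightarrow> g C \<in> Z" "\<And>C. C \<in> S \<Longrightarrow> C = g C +o B"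
    by metis
  define h where "h = (\<lambda>C. \<pi> (g C))"
  have comb: "coset_comb s B T r = (\<Sum>C\<in>T. s (r C) (g C)) +o B"
    if "finite T" "T \<subseteq> S" for T r
    using coset_comb_image[OF assms(1) B that(1) inj_on_id, of g r] g that by auto
  have inj: "inj_on h S"
  proof
    fix C D assume CD: "C \<in> S" "D \<in> S" "h C = h D"
    then have "\<pi> (g C - g D) = 0"
      by (simp add: h_def lp.diff)
    then have "g C +o B = g D +o B"
      by (simp add: ker coset_eq)
    then show "C = D"
      using g CD by metis
  qed
  have "independent (h ` S)"
    unfolding independent_explicit_module
  proof (intro allI impI)
    fix t u v assume t: "finite t" "t \<subseteq> h ` S" "(\<Sum>v\<in>t. s (u v) v) = 0" "v \<in> t"
    then obtain T where T: "T \<subseteq> S" "finite T" "t = h ` T"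
      by (meson finite_subset_image)
    have "inj_on h T"
      using inj T(1) by (rule inj_on_subset)
    then have "\<pi> (\<Sum>C\<in>T. s (u (h C)) (g C)) = 0"
      using t(3) T(3) by (simp add: sum.reindex lp.sum lp.scale h_def)
    then have "coset_comb s B T (\<lambda>C. u (h C)) = B"
      by (simp add: comb T coset_mem ker)
    then have "\<forall>C\<in>T. u (h C) = 0"
      using S T(1,2) unfolding quotient_basis_def quotient_independent_def by blast
    then show "u v = 0"
      using t(4) T(3) by auto
  qed
  moreover have "\<pi> ` Z \<subseteq> span (h ` S)"
  proof
    fix y assume "y \<in> \<pi> ` Z"
    then obtain z where z: "z \<in> Z" "y = \<pi> z"
      by auto
    then have "z +o B \<in> quotient_span s B S"
      using S by (auto simp: quotient_basis_def quotient_space_def)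
    then obtain T r where T: "finite T" "T \<subseteq> S" "z +o B = coset_comb s B T r"
      by (auto simp: quotient_span_def)
    then have "\<pi> (z - (\<Sum>C\<in>T. s (r C) (g C))) = 0"
      by (simp add: comb coset_eq ker)
    then have "y = (\<Sum>C\<in>T. s (r C) (h C))"
      using z by (simp add: lp.diff lp.sum lp.scale h_def)
    also have "\<dots> \<in> span (h ` S)"
      using T(2) by (intro span_sum span_scale span_base) auto
    finally show "y \<in> span (h ` S)" .
  qed
  moreover have "h ` S \<subseteq> \<pi> ` Z"
    using g by (auto simp: h_def)
  ultimately have "card (h ` S) = dim (\<pi> ` Z)"
    by (intro basis_card_eq_dim) auto
  then show ?thesis
    using inj by (simp add: card_image)
qed

text \<open>\<open>quotient_dim\<close> is the cardinality of a basis picked by \<open>SOME\<close>;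
  that basis and \<open>S\<close> are both counted by the dimension of the same image.\<close>

lemma quotient_dim_eq_card:
  assumes "vector_space s" and "module.subspace s B" and S: "quotient_basis s Z B S"
  shows "quotient_dim s Z B = card S"
proof -
  obtain \<pi> where \<pi>: "Vector_Spaces.linear s s \<pi>" "\<And>v. \<pi> v = 0 \<longleftrightarrow> v \<in> B"
    using exists_linear_kernel_eq[OF assms(1,2)] by blast
  have "quotient_basis s Z B (SOME S. quotient_basis s Z B S)"
    using S by (rule someI)
  then show ?thesis
    unfolding quotient_dim_def using card_quotient_basis[OF assms(1,2) \<pi>] S by metis
qed

text \<open>Reduces a basis claim to coefficient statements about representatives modulo
  \<open>B\<close>. Since coefficients belong to list positions, \<open>indep\<close> also forces
  the cosets to be pairwise distinct, so that the dimension is the length of the list.\<close>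

lemma quotient_basis_list:
  fixes s :: "'a::field \<Rightarrow> 'v::ab_group_add \<Rightarrow> 'v"
  assumes "vector_space s" and B: "module.subspace s B" and Z: "module.subspace s Z"
    and vs: "set vs \<subseteq> Z"
    and indep: "\<And>r. (\<Sum>i<length vs. s (r i) (vs ! i)) \<in> B \<Longrightarrow> \<forall>i<length vs. r i = 0"
    and spans: "\<And>z. z \<in> Z \<Longrightarrow> \<exists>r. z - (\<Sum>i<length vs. s (r i) (vs ! i)) \<in> B"
  shows "quotient_basis s Z B ((\<lambda>v. v +o B) ` set vs)"
    and "quotient_dim s Z B = length vs"
proof -
  interpret vector_space s by fact
  let ?n = "length vs"
  define F where "F i = vs ! i +o B" for i
  have img: "(\<lambda>v. v +o B) ` set vs = F ` {..<?n}"
    by (simp add: F_def set_conv_nth image_image setcompr_eq_image lessThan_def)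
  note coset_eq = coset_eq_iff[OF assms(1) B] and coset_mem = coset_eq_iff_mem[OF assms(1) B]
  have inj: "inj_on F {..<?n}"
  proof (rule inj_onI, rule ccontr)
    fix i j assume ij: "i \<in> {..<?n}" "j \<in> {..<?n}" "F i = F j" "i \<noteq> j"
    \<comment> \<open>If two positions gave the same coset, the coefficients 1 and -1 there would
      give a non-trivial combination in \<open>B\<close>.\<close>
    define r :: "nat \<Rightarrow> 'a" where "r k = (if k = i then 1 else 0) - (if k = j then 1 else 0)" for k
    have "s (r k) (vs ! k) = (if k = i then vs ! k else 0) - (if k = j then vs ! k else 0)" for k
      using ij(4) by (auto simp: r_def scale_left_diff_distrib)
    then have "(\<Sum>k<?n. s (r k) (vs ! k)) = vs ! i - vs ! j"
      using ij(1,2) by (simp add: sum_subtractf)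
    then have "(\<Sum>k<?n. s (r k) (vs ! k)) \<in> B"
      using ij(3) by (simp add: F_def coset_eq)
    then have "r i = 0"
      using indep ij(1) by blast
    then show False
      using ij(4) by (simp add: r_def)
  qed
  have comb: "coset_comb s B (F ` I) r = (\<Sum>i\<in>I. s (r (F i)) (vs ! i)) +o B"
    if "I \<subseteq> {..<?n}" for I r
    using that inj by (intro coset_comb_image[OF assms(1) B])
      (auto simp: F_def intro: finite_subset inj_on_subset)
  have ZI: "vs ! i \<in> Z" if "i < ?n" for i
    using vs that by auto
  have "quotient_independent s B (F ` {..<?n})"
    unfolding quotient_independent_def
  proof (intro allI impI ballI)
    fix T r C
    assume T: "finite T \<and> T \<subseteq> F ` {..<?n} \<and> coset_comb s B T r = B" and C: "C \<in> T"
    then obtain I where I: "I \<subseteq> {..<?n}" "T = F ` I"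
      by (meson subset_imageE)
    \<comment> \<open>Extension by 0, because \<open>indep\<close> speaks of combinations of the
      whole list.\<close>
    define q where "q i = (if i \<in> I then r (F i) else 0)" for i
    have "(\<Sum>i<?n. s (q i) (vs ! i)) = (\<Sum>i\<in>I. s (r (F i)) (vs ! i))"
      using I(1) by (intro sum.mono_neutral_cong_right) (auto simp: q_def)
    also have "\<dots> \<in> B"
      using T I by (simp add: comb coset_mem)
    finally have "\<forall>i<?n. q i = 0"
      by (rule indep)
    then show "r C = 0"
      using C I by (auto simp: q_def)
  qed
  moreover have "F ` {..<?n} \<subseteq> quotient_space Z B"
    using ZI by (auto simp: F_def quotient_space_def)
  moreover have "quotient_span s B (F ` {..<?n}) = quotient_space Z B"
  proof
    show "quotient_span s B (F ` {..<?n}) \<subseteq> quotient_space Z B"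
    proof
      fix C assume "C \<in> quotient_span s B (F ` {..<?n})"
      then obtain I r where I: "I \<subseteq> {..<?n}" "C = coset_comb s B (F ` I) r"
        unfolding quotient_span_def by (auto elim: subset_imageE)
      have "(\<Sum>i\<in>I. s (r (F i)) (vs ! i)) \<in> Z"
        using I(1) ZI by (auto intro!: subspace_sum[OF Z] subspace_scale[OF Z])
      then show "C \<in> quotient_space Z B"
        using I by (simp add: comb quotient_space_def)
    qed
    show "quotient_space Z B \<subseteq> quotient_span s B (F ` {..<?n})"
    proof
      fix C assume "C \<in> quotient_space Z B"
      then obtain z where z: "z \<in> Z" "C = z +o B"
        by (auto simp: quotient_space_def)
      then obtain r where "z - (\<Sum>i<?n. s (r i) (vs ! i)) \<in> B"
        using spans by blast
      then have "C = (\<Sum>i<?n. s (r i) (vs ! i)) +o B"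
        using z by (simp add: coset_eq)
      \<comment> \<open>Coefficients in \<open>coset_comb\<close> are indexed by cosets; inverting
        \<open>F\<close> recovers the list position.\<close>
      also have "\<dots> = coset_comb s B (F ` {..<?n}) (\<lambda>C. r (inv_into {..<?n} F C))"
        by (simp add: comb inv_into_f_f[OF inj])
      finally show "C \<in> quotient_span s B (F ` {..<?n})"
        by (auto simp: quotient_span_def)
    qed
  qed
  ultimately show basis: "quotient_basis s Z B ((\<lambda>v. v +o B) ` set vs)"
    by (simp add: quotient_basis_def img)
  show "quotient_dim s Z B = length vs"
    using quotient_dim_eq_card[OF assms(1) B basis] inj by (simp add: img card_image)
qed

section \<open>Cocycles and coboundaries of the Heisenberg algebra\<close>

definition heis_cochain ::
    "'a::field ^ 3 \<Rightarrow> 'a ^ 3 \<Rightarrow> 'a ^ 3 \<Rightarrow> 'a ^ 3 \<Rightarrow> 'a ^ 3 \<Rightarrow> 'a ^ 3 \<Rightarrow>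
      ('a ^ 3 \<Rightarrow> 'a ^ 3 \<Rightarrow> 'a ^ 3) \<times> ('a ^ 3 \<Rightarrow> 'a ^ 3)"
  where "heis_cochain a b c d e f = (heis_alt a b c, heis_semi d e f)"

lemma heis_alt_basis [simp]:
  "heis_alt a b c hx hy = a" "heis_alt a b c hx hz = b" "heis_alt a b c hy hz = c"
  by (simp_all add: heis_alt_def)

lemma heis_semi_basis:
  fixes a b c :: "'a::field ^ 3"
  assumes "CHAR('a) > 3"
  shows "heis_semi a b c hx = a" "heis_semi a b c hy = b" "heis_semi a b c hz = c"
proof -
  \<comment> \<open>The exponent is positive here; in characteristic 0 the power would be
    \<open>0 ^ 0 = 1\<close>.\<close>
  have zero: "(0 :: 'a) ^ CHAR('a) = 0"
    using assms by (intro zero_power) simp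
  show "heis_semi a b c hx = a" "heis_semi a b c hy = b" "heis_semi a b c hz = c"
    by (simp_all add: heis_semi_def zero)
qed

lemma heis_cochain_eq_iff:
  fixes a b c :: "'a::field ^ 3"
  assumes "CHAR('a) > 3"
  shows "heis_cochain a b c d e f = heis_cochain a' b' c' d' e' f' \<longleftrightarrow>
    a = a' \<and> b = b' \<and> c = c' \<and> d = d' \<and> e = e' \<and> f = f'" (is "?L \<longleftrightarrow> ?R")
proof
  assume ?L
  then have alt: "heis_alt a b c u v = heis_alt a' b' c' u v"
    and semi: "heis_semi d e f u = heis_semi d' e' f' u" for u v
    by (simp_all add: heis_cochain_def)
  show ?R
    using alt[of hx hy] alt[of hx hz] alt[of hy hz] semi[of hx] semi[of hy] semi[of hz]
    by (simp add: heis_semi_basis[OF assms])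
qed simp

lemma heis_cochain_add:
  "heis_cochain a b c d e f + heis_cochain a' b' c' d' e' f' =
    heis_cochain (a + a') (b + b') (c + c') (d + d') (e + e') (f + f')"
  by (auto simp: heis_cochain_def heis_alt_def heis_semi_def vec_eq_iff fun_eq_iff algebra_simps)

lemma heis_cochain_diff:
  "heis_cochain a b c d e f - heis_cochain a' b' c' d' e' f' =
    heis_cochain (a - a') (b - b') (c - c') (d - d') (e - e') (f - f')"
  by (auto simp: heis_cochain_def heis_alt_def heis_semi_def vec_eq_iff fun_eq_iff algebra_simps)

text \<open>Oriented so that rewriting turns the zero pair into coordinates, where the membership
  criteria for \<open>Z2\<close> and \<open>B2\<close> apply.\<close>

lemma heis_cochain_zero: "0 = heis_cochain 0 0 0 0 0 0"
  by (auto simp: heis_cochain_def heis_alt_def heis_semi_def zero_prod_def vec_eq_iff fun_eq_iff)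

lemma heis_cochain_alt: "(heis_alt a b c, 0) = heis_cochain a b c 0 0 0"
  by (auto simp: heis_cochain_def heis_semi_def vec_eq_iff fun_eq_iff)

lemma heis_cochain_semi: "(0, heis_semi d e f) = heis_cochain 0 0 0 d e f"
  by (auto simp: heis_cochain_def heis_alt_def vec_eq_iff fun_eq_iff)

section \<open>Cocycle and coboundary conditions as linear equations\<close>

context
  fixes \<theta> :: "'a::field ^ 3 \<Rightarrow> 'a"
  assumes char: "CHAR('a) > 3"
begin

interpretation restricted_lie_algebra "(*s)" heis_bracket "heis_pmap \<theta>"
  by (rule heis_restricted_lie_algebra) (rule char)

lemma heis_cochain_scale:
  "pair_scale r (heis_cochain a b c d e f) =
    heis_cochain (r *s a) (r *s b) (r *s c) (r *s d) (r *s e) (r *s f)"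
  by (auto simp: pair_scale_def heis_cochain_def heis_alt_def heis_semi_def vec_eq_iff fun_eq_iff
      algebra_simps)

text \<open>An alternating trilinear map on a 3-dimensional space is a multiple of the determinant,
  here that of the coordinates of \<open>u\<close>, \<open>v\<close>, \<open>w\<close>. At the basis
  only \<open>- [x, c] + [y, b]\<close> survives, since \<open>z\<close> is central and
  \<open>\<phi>(z, z) = 0\<close>; this gives the coefficient.\<close>

lemma heis_d2_CE:
  "d2_CE (heis_alt a b c) u v w =
    (- (b $ 1 + c $ 2) * (u $ 1 * (v $ 2 * w $ 3 - v $ 3 * w $ 2)
      - u $ 2 * (v $ 1 * w $ 3 - v $ 3 * w $ 1) + u $ 3 * (v $ 1 * w $ 2 - v $ 2 * w $ 1))) *s hz"
  by (simp add: d2_CE_def heis_alt_def heis_bracket_def vec_eq_iff forall_3 algebra_simps)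

text \<open>In each summand \<open>i + j = p - 1 \<ge> 3\<close>, so \<open>i \<ge> 2\<close> or
  \<open>j \<ge> 2\<close>. In the first case the outer iterated bracket vanishes, in the second the
  first argument of the alternating map.\<close>

lemma heis_ind2:
  "ind2 (heis_alt a b c) \<omega> u v = heis_alt a b c u (heis_pmap \<theta> v) + heis_bracket u (\<omega> v)"
proof -
  have "(heis_bracket v ^^ i) (heis_alt a b c (((\<lambda>w. heis_bracket w v) ^^ j) u) v) = 0"
    if "i + j = CHAR('a) - 1" for i j
  proof (cases "i \<ge> 2")
    case True
    then show ?thesis by (simp add: heis_bracket_iterate)
  next
    case False
    then have "j \<ge> 2"
      using that char by linarith
    moreover have "(heis_bracket v ^^ i) 0 = 0"
      by (induction i) auto
    ultimately show ?thesis
      by (simp add: heis_bracket_iterate heis_alt_def)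
  qed
  then show ?thesis
    by (auto simp: ind2_def intro!: sum.neutral)
qed

text \<open>The relation between \<open>b\<close> and \<open>c\<close> is the Chevalley-Eilenberg
  condition. Each pair \<open>(t, w)\<close> collects the values of \<open>\<theta>\<close> and
  \<omega> at one basis vector; the two equations say that \<open>ind2\<close> vanishes there with
  first argument \<open>x\<close> and \<open>y\<close>. The first argument \<open>z\<close> gives
  nothing, as \<open>z\<close> is central and the p-map takes values in its span.\<close>

lemma heis_cochain_in_Z2_iff:
  "heis_cochain a b c d e f \<in> Z2 \<longleftrightarrow> c $ 2 = - b $ 1 \<and>
    (\<forall>(t, w) \<in> {(\<theta> hx, d), (\<theta> hy, e), (\<theta> hz, f)}.
      t *s b = (- w $ 2) *s hz \<and> t *s c = (w $ 1) *s hz)"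
    (is "_ \<longleftrightarrow> ?R")
proof -
  have C2: "(heis_alt a b c, heis_semi d e f) \<in> C2"
    using heis_C2[OF char] by blast
  \<comment> \<open>Linear in \<open>u\<close> and p-semilinear in \<open>v\<close>, so six pairs of
    basis vectors suffice below.\<close>
  have eq: "ind2 (heis_alt a b c) (heis_semi d e f) u v =
      u $ 1 *s ((v $ 1) ^ CHAR('a) *s (\<theta> hx *s b + d $ 2 *s hz)
        + (v $ 2) ^ CHAR('a) *s (\<theta> hy *s b + e $ 2 *s hz)
        + (v $ 3) ^ CHAR('a) *s (\<theta> hz *s b + f $ 2 *s hz))
      + u $ 2 *s ((v $ 1) ^ CHAR('a) *s (\<theta> hx *s c - d $ 1 *s hz)
        + (v $ 2) ^ CHAR('a) *s (\<theta> hy *s c - e $ 1 *s hz)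
        + (v $ 3) ^ CHAR('a) *s (\<theta> hz *s c - f $ 1 *s hz))" for u v
    by (simp add: heis_ind2 heis_alt_def heis_pmap_def heis_bracket_def heis_semi_def vec_eq_iff
        forall_3 algebra_simps)
  have ind: "(\<forall>u v. ind2 (heis_alt a b c) (heis_semi d e f) u v = 0) \<longleftrightarrow>
      (\<forall>(t, w) \<in> {(\<theta> hx, d), (\<theta> hy, e), (\<theta> hz, f)}.
        t *s b + w $ 2 *s hz = 0 \<and> t *s c - w $ 1 *s hz = 0)" (is "?L \<longleftrightarrow> ?M")
  proof
    assume ?L
    then have "ind2 (heis_alt a b c) (heis_semi d e f) u v = 0" for u v
      by blast
    note this[of hx hx] this[of hx hy] this[of hx hz] this[of hy hx] this[of hy hy] this[of hy hz]
    moreover have zero: "(0 :: 'a) ^ CHAR('a) = 0"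
      using char by (intro zero_power) simp
    ultimately show ?M
      by (simp add: eq zero)
  next
    assume ?M
    then show ?L by (simp add: eq)
  qed
  have d2: "(\<forall>u v w. d2_CE (heis_alt a b c) u v w = 0) \<longleftrightarrow> c $ 2 = - b $ 1" (is "?L \<longleftrightarrow> ?M")
  proof
    assume ?L
    then have "d2_CE (heis_alt a b c) hx hy hz $ 3 = 0"
      by simp
    then show ?M
      by (simp add: heis_d2_CE eq_neg_iff_add_eq_0 add.commute)
  qed (simp add: heis_d2_CE)
  have "v + r *s hz = 0 \<longleftrightarrow> v = (- r) *s hz" for v :: "'a ^ 3" and r
    by (simp add: eq_neg_iff_add_eq_0)
  then show ?thesis
    unfolding Z2_def heis_cochain_def using C2 ind d2 by auto
qed

lemma heis_Z2_cases:
  assumes "u \<in> Z2"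
  obtains a b c d e f where "u = heis_cochain a b c d e f"
proof -
  have "u \<in> C2"
    using assms by (auto simp: Z2_def)
  then show thesis
    using that unfolding heis_C2[OF char] heis_cochain_def by blast
qed

text \<open>By nilpotency the iterated bracket in \<open>ind1\<close> vanishes, leaving
  \<open>\<psi>\<close> at the p-th power, a multiple of \<open>\<psi> hz\<close>. Brackets with
  \<open>\<psi> hx\<close> and \<open>\<psi> hy\<close> enter only at \<open>(x, y)\<close>, through
  the sum of two coordinates.\<close>

lemma heis_coboundary:
  assumes "Vector_Spaces.linear (*s) (*s) \<psi>"
  shows "(d1_CE \<psi>, ind1 \<psi>) =
    heis_cochain (\<psi> hz - (\<psi> hx $ 1 + \<psi> hy $ 2) *s hz) ((- \<psi> hz $ 2) *s hz) ((\<psi> hz $ 1) *s hz)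
      (\<theta> hx *s \<psi> hz) (\<theta> hy *s \<psi> hz) (\<theta> hz *s \<psi> hz)"
proof -
  interpret lp: Vector_Spaces.linear "(*s)" "(*s)" \<psi> by fact
  have \<psi>: "\<psi> u = u $ 1 *s \<psi> hx + u $ 2 *s \<psi> hy + u $ 3 *s \<psi> hz" for u
    by (subst heis_decomp) (simp only: lp.add lp.scale)
  have br: "heis_bracket u (\<psi> v) = (u $ 1 * (v $ 1 * \<psi> hx $ 2 + v $ 2 * \<psi> hy $ 2 + v $ 3 * \<psi> hz $ 2)
      - u $ 2 * (v $ 1 * \<psi> hx $ 1 + v $ 2 * \<psi> hy $ 1 + v $ 3 * \<psi> hz $ 1)) *s hz" for u v
    by (subst \<psi>) (simp add: heis_bracket_def)
  have \<psi>_br: "\<psi> (heis_bracket u v) = (u $ 1 * v $ 2 - u $ 2 * v $ 1) *s \<psi> hz" for u v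
    by (simp add: heis_bracket_def lp.scale)
  have "d1_CE \<psi> u v = heis_alt (\<psi> hz - (\<psi> hx $ 1 + \<psi> hy $ 2) *s hz)
      ((- \<psi> hz $ 2) *s hz) ((\<psi> hz $ 1) *s hz) u v" for u v
    unfolding d1_CE_def br \<psi>_br by (simp add: heis_alt_def vec_eq_iff forall_3 algebra_simps)
  moreover have "ind1 \<psi> u = heis_semi (\<theta> hx *s \<psi> hz) (\<theta> hy *s \<psi> hz) (\<theta> hz *s \<psi> hz) u" for u
  proof -
    have "ind1 \<psi> u = \<psi> (heis_pmap \<theta> u)"
      using char by (simp add: ind1_def heis_bracket_iterate)
    also have "\<dots> = (u $ 1 ^ CHAR('a) * \<theta> hx + u $ 2 ^ CHAR('a) * \<theta> hy + u $ 3 ^ CHAR('a) * \<theta> hz) *s \<psi> hz"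
      unfolding heis_pmap_def by (rule lp.scale)
    finally show ?thesis
      by (simp add: heis_semi_def vec_eq_iff algebra_simps)
  qed
  ultimately show ?thesis
    by (simp add: heis_cochain_def fun_eq_iff)
qed

lemma heis_B2:
  "B2 = {heis_cochain (s + t *s hz) ((- s $ 2) *s hz) ((s $ 1) *s hz)
    (\<theta> hx *s s) (\<theta> hy *s s) (\<theta> hz *s s) | s t. True}" (is "_ = ?R")
proof
  show "B2 \<subseteq> ?R"
  proof
    fix u assume "u \<in> B2"
    then obtain \<psi> where \<psi>: "Vector_Spaces.linear (*s) (*s) \<psi>" "u = (d1_CE \<psi>, ind1 \<psi>)"
      by (auto simp: B2_def)
    have "u = heis_cochain (\<psi> hz + (- (\<psi> hx $ 1 + \<psi> hy $ 2)) *s hz) ((- \<psi> hz $ 2) *s hz)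
        ((\<psi> hz $ 1) *s hz) (\<theta> hx *s \<psi> hz) (\<theta> hy *s \<psi> hz) (\<theta> hz *s \<psi> hz)"
      unfolding \<psi>(2) heis_coboundary[OF \<psi>(1)] vec.scale_minus_left by simp
    then show "u \<in> ?R"
      by blast
  qed
  show "?R \<subseteq> B2"
  proof
    fix u assume "u \<in> ?R"
    then obtain s t where u: "u = heis_cochain (s + t *s hz) ((- s $ 2) *s hz) ((s $ 1) *s hz)
      (\<theta> hx *s s) (\<theta> hy *s s) (\<theta> hz *s s)"
      by blast
    \<comment> \<open>Sends \<open>z\<close> to \<open>s\<close>, \<open>x\<close> to
      \<open>- t *s hx\<close> and \<open>y\<close> to 0, thus realising both parameters
      independently.\<close>
    define \<psi> where "\<psi> v = v $ 3 *s s - (t * v $ 1) *s hx" for v :: "'a ^ 3"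
    have lin: "Vector_Spaces.linear (*s) (*s) \<psi>"
      by (auto simp: Vector_Spaces.linear_iff \<psi>_def vec_eq_iff algebra_simps
          vec.vector_space_axioms)
    have "\<psi> hz = s" "\<psi> hx $ 1 = - t" "\<psi> hy $ 2 = 0"
      by (simp_all add: \<psi>_def)
    then have "u = (d1_CE \<psi>, ind1 \<psi>)"
      unfolding heis_coboundary[OF lin] u by simp
    then show "u \<in> B2"
      using lin by (auto simp: B2_def)
  qed
qed

text \<open>The free multiple of \<open>hz\<close> in the first slot absorbs the third coordinate of
  \<open>a\<close>, so \<open>a\<close> fixes only two coordinates of \<open>s\<close>; the third is
  constrained by \<open>d\<close>, \<open>e\<close>, \<open>f\<close> alone.\<close>

lemma heis_cochain_in_B2_iff:
  "heis_cochain a b c d e f \<in> B2 \<longleftrightarrow> b = (- a $ 2) *s hz \<and> c = (a $ 1) *s hz \<and>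
    (\<exists>s. s $ 1 = a $ 1 \<and> s $ 2 = a $ 2 \<and> d = \<theta> hx *s s \<and> e = \<theta> hy *s s \<and> f = \<theta> hz *s s)"
    (is "?L \<longleftrightarrow> ?R")
proof
  assume ?L
  then show ?R
    unfolding heis_B2 by (auto simp: heis_cochain_eq_iff[OF char])
next
  assume ?R
  then obtain s where s: "s $ 1 = a $ 1" "s $ 2 = a $ 2"
    "d = \<theta> hx *s s" "e = \<theta> hy *s s" "f = \<theta> hz *s s" "b = (- a $ 2) *s hz" "c = (a $ 1) *s hz"
    by blast
  then have "a = s + (a $ 3 - s $ 3) *s hz"
    by (simp add: vec_eq_iff forall_3)
  then show ?L
    unfolding heis_B2 using s by (auto simp: heis_cochain_eq_iff[OF char])
qed

section \<open>Subspace properties and the criterion for bases of the cohomology\<close>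

lemma subspace_heis_Z2: "pair.subspace Z2"
  unfolding pair.subspace_def
proof (intro conjI ballI allI)
  show "0 \<in> Z2"
    by (simp add: heis_cochain_zero heis_cochain_in_Z2_iff)
next
  fix u v assume uv: "u \<in> Z2" "v \<in> Z2"
  obtain a b c d e f where u: "u = heis_cochain a b c d e f"
    using uv(1) by (rule heis_Z2_cases)
  obtain a' b' c' d' e' f' where v: "v = heis_cochain a' b' c' d' e' f'"
    using uv(2) by (rule heis_Z2_cases)
  show "u + v \<in> Z2"
    using uv unfolding u v
    by (simp add: heis_cochain_add heis_cochain_in_Z2_iff vec.scale_right_distrib
        vec.scale_left_distrib)
next
  fix r u assume ru: "u \<in> Z2"
  obtain a b c d e f where u: "u = heis_cochain a b c d e f"
    using ru by (rule heis_Z2_cases)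
  have comm: "t * r * x = r * (t * x)" for t x :: 'a
    by simp
  show "pair_scale r u \<in> Z2"
    using ru unfolding u
    by (simp add: heis_cochain_scale heis_cochain_in_Z2_iff vec_eq_iff forall_3 comm)
qed

lemma subspace_heis_B2: "pair.subspace B2"
  unfolding pair.subspace_def
proof (intro conjI ballI allI)
  show "0 \<in> B2"
    by (auto simp: heis_cochain_zero heis_cochain_in_B2_iff intro: exI[of _ 0])
next
  fix u v assume "u \<in> B2" "v \<in> B2"
  then obtain s t s' t' where
    "u = heis_cochain (s + t *s hz) ((- s $ 2) *s hz) ((s $ 1) *s hz)
      (\<theta> hx *s s) (\<theta> hy *s s) (\<theta> hz *s s)"
    "v = heis_cochain (s' + t' *s hz) ((- s' $ 2) *s hz) ((s' $ 1) *s hz)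
      (\<theta> hx *s s') (\<theta> hy *s s') (\<theta> hz *s s')"
    unfolding heis_B2 by blast
  then show "u + v \<in> B2"
    by (simp only: heis_cochain_add heis_cochain_in_B2_iff, intro conjI exI[of _ "s + s'"])
      (simp_all add: vec_eq_iff forall_3 algebra_simps)
next
  fix r u assume "u \<in> B2"
  then obtain s t where
    "u = heis_cochain (s + t *s hz) ((- s $ 2) *s hz) ((s $ 1) *s hz)
      (\<theta> hx *s s) (\<theta> hy *s s) (\<theta> hz *s s)"
    unfolding heis_B2 by blast
  then show "pair_scale r u \<in> B2"
    by (simp only: heis_cochain_scale heis_cochain_in_B2_iff, intro conjI exI[of _ "r *s s"])
      (simp_all add: vec_eq_iff forall_3 algebra_simps)
qed

lemma heis_H2_basis_list:
  assumes "set vs \<subseteq> Z2"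
    and "\<And>r. (\<Sum>i<length vs. pair_scale (r i) (vs ! i)) \<in> B2 \<Longrightarrow> \<forall>i<length vs. r i = 0"
    and "\<And>z. z \<in> Z2 \<Longrightarrow> \<exists>r. z - (\<Sum>i<length vs. pair_scale (r i) (vs ! i)) \<in> B2"
  shows "H2_basis (H2_class ` set vs)" and "H2_dim = length vs"
  using quotient_basis_list[OF pair.vector_space_axioms subspace_heis_B2 subspace_heis_Z2 assms]
  unfolding H2_basis_def H2_dim_def H2_class_def by simp_all

end

section \<open>The three algebras\<close>

lemma all_lessThan_8: "(\<forall>i<8. P i) \<longleftrightarrow> P 7 \<and> P 6 \<and> P 5 \<and> P 4 \<and> P 3 \<and> P 2 \<and> P 1 \<and> P (0::nat)"
  by (simp add: eval_nat_numeral All_less_Suc)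

lemma all_lessThan_4: "(\<forall>i<4. P i) \<longleftrightarrow> P 3 \<and> P 2 \<and> P 1 \<and> P (0::nat)"
  by (simp add: eval_nat_numeral All_less_Suc)

text \<open>For \<open>\<theta> = 0\<close> cocycles have \<omega>-values in the span of
  \<open>z\<close>, and coboundaries have zero \<omega>-part. Modulo coboundaries \<open>a\<close>
  becomes 0; \<open>b\<close> and \<open>c\<close> keep 6 coordinates with one relation, and
  \<omega> keeps 3, giving 5 + 3.\<close>

lemma heis_H2_zero:
  assumes "CHAR('a::field) > 3"
  shows "heis_H2_basis (0 :: 'a ^ 3 \<Rightarrow> 'a) (heis_H2_class 0 `
      {(heis_alt 0 hz 0, 0), (heis_alt 0 0 hz, 0), (heis_alt 0 hx (- hy), 0),
       (heis_alt 0 hy 0, 0), (heis_alt 0 0 hx, 0),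
       (0, heis_semi hz 0 0), (0, heis_semi 0 hz 0), (0, heis_semi 0 0 hz)})"
    and "heis_H2_dim (0 :: 'a ^ 3 \<Rightarrow> 'a) = 8"
proof -
  interpret restricted_lie_algebra "(*s)" heis_bracket "heis_pmap (0 :: 'a ^ 3 \<Rightarrow> 'a)"
    by (rule heis_restricted_lie_algebra) fact
  let ?vs = "[(heis_alt 0 hz 0, 0), (heis_alt 0 0 hz, 0), (heis_alt 0 hx (- hy), 0),
       (heis_alt 0 hy 0, 0), (heis_alt 0 0 hx, 0),
       (0, heis_semi hz 0 0), (0, heis_semi 0 hz 0), (0, heis_semi 0 0 hz)]
       :: (('a ^ 3 \<Rightarrow> 'a ^ 3 \<Rightarrow> 'a ^ 3) \<times> ('a ^ 3 \<Rightarrow> 'a ^ 3)) list"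
  have len: "length ?vs = 8" by simp
  note simps = heis_cochain_scale[OF assms] heis_cochain_in_Z2_iff[OF assms]
    heis_cochain_in_B2_iff[OF assms] heis_cochain_alt heis_cochain_semi
    heis_cochain_add heis_cochain_diff
  have comb: "(\<Sum>i<length ?vs. pair_scale (r i) (?vs ! i)) = heis_cochain 0
      (r 2 *s hx + r 3 *s hy + r 0 *s hz) (r 4 *s hx - r 2 *s hy + r 1 *s hz)
      (r 5 *s hz) (r 6 *s hz) (r 7 *s hz)" for r
    by (simp add: eval_nat_numeral simps algebra_simps)
  have cocycles: "set ?vs \<subseteq> Z2"
    by (simp add: simps)
  have indep: "\<forall>i<length ?vs. r i = 0"
    if "(\<Sum>i<length ?vs. pair_scale (r i) (?vs ! i)) \<in> B2" for r
    using that unfolding comb unfolding len all_lessThan_8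
    by (auto simp: simps vec_eq_iff forall_3)
  have spans: "\<exists>r. z - (\<Sum>i<length ?vs. pair_scale (r i) (?vs ! i)) \<in> B2" if mem: "z \<in> Z2" for z
  proof -
    obtain a b c d e f where z: "z = heis_cochain a b c d e f"
      using heis_Z2_cases[OF assms mem] by blast
    have "c $ 2 = - b $ 1" "d $ 1 = 0" "d $ 2 = 0" "e $ 1 = 0" "e $ 2 = 0" "f $ 1 = 0" "f $ 2 = 0"
      using mem unfolding z by (auto simp: simps vec_eq_iff forall_3)
    then show ?thesis
      unfolding comb z
      \<comment> \<open>The coboundary with \<open>s = a\<close> has \<open>- a $ 2\<close> and
        \<open>a $ 1\<close> as the \<open>z\<close>-coordinates of its second and third slots,
        which explains the two corrected coefficients.\<close>
      by (intro exI[of _ "(!) [b $ 3 + a $ 2, c $ 3 - a $ 1, b $ 1, b $ 2, c $ 1, d $ 3, e $ 3, f $ 3]"])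
        (auto simp: simps vec_eq_iff forall_3 intro!: exI[of _ a])
  qed
  show "H2_dim = 8"
    "H2_basis (H2_class ` {(heis_alt 0 hz 0, 0), (heis_alt 0 0 hz, 0), (heis_alt 0 hx (- hy), 0),
       (heis_alt 0 hy 0, 0), (heis_alt 0 0 hx, 0),
       (0, heis_semi hz 0 0), (0, heis_semi 0 hz 0), (0, heis_semi 0 0 hz)})"
    using heis_H2_basis_list[OF assms cocycles indep spans] unfolding len list.set by simp_all
qed

text \<open>Since \<open>\<theta> hx = 1\<close>, the cocycle equations express \<open>b\<close> and
  \<open>c\<close> by the arbitrary vector \<open>d\<close>, and the coboundary with
  \<open>s = d\<close> removes all three. What remains are two coordinates of \<open>a\<close> and
  the \<open>z\<close>-coordinates of \<open>e\<close> and \<open>f\<close>.\<close>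

lemma heis_H2_x_dual:
  assumes "CHAR('a::field) > 3"
  shows "heis_H2_basis (x_dual :: 'a ^ 3 \<Rightarrow> 'a) (heis_H2_class x_dual `
      {(heis_alt hx 0 0, 0), (heis_alt hy 0 0, 0), (0, heis_semi 0 hz 0), (0, heis_semi 0 0 hz)})"
    and "heis_H2_dim (x_dual :: 'a ^ 3 \<Rightarrow> 'a) = 4"
proof -
  interpret restricted_lie_algebra "(*s)" heis_bracket "heis_pmap (x_dual :: 'a ^ 3 \<Rightarrow> 'a)"
    by (rule heis_restricted_lie_algebra) fact
  let ?vs = "[(heis_alt hx 0 0, 0), (heis_alt hy 0 0, 0), (0, heis_semi 0 hz 0), (0, heis_semi 0 0 hz)]
       :: (('a ^ 3 \<Rightarrow> 'a ^ 3 \<Rightarrow> 'a ^ 3) \<times> ('a ^ 3 \<Rightarrow> 'a ^ 3)) list"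
  have len: "length ?vs = 4" by simp
  note simps = heis_cochain_scale[OF assms] heis_cochain_in_Z2_iff[OF assms]
    heis_cochain_in_B2_iff[OF assms] heis_cochain_alt heis_cochain_semi
    heis_cochain_add heis_cochain_diff x_dual_def
  have comb: "(\<Sum>i<length ?vs. pair_scale (r i) (?vs ! i)) = heis_cochain
      (r 0 *s hx + r 1 *s hy) 0 0 0 (r 2 *s hz) (r 3 *s hz)" for r
    by (simp add: eval_nat_numeral simps algebra_simps)
  have cocycles: "set ?vs \<subseteq> Z2"
    by (simp add: simps)
  \<comment> \<open>The combination has \<open>b = c = 0\<close>, which for a coboundary forces
    \<open>a $ 1 = a $ 2 = 0\<close>; its values of \<omega> at \<open>y\<close> and
    \<open>z\<close> vanish because \<open>\<theta>\<close> does.\<close>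
  have indep: "\<forall>i<length ?vs. r i = 0"
    if "(\<Sum>i<length ?vs. pair_scale (r i) (?vs ! i)) \<in> B2" for r
    using that unfolding comb unfolding len all_lessThan_4
    by (auto simp: simps vec_eq_iff forall_3)
  have spans: "\<exists>r. z - (\<Sum>i<length ?vs. pair_scale (r i) (?vs ! i)) \<in> B2" if mem: "z \<in> Z2" for z
  proof -
    obtain a b c d e f where z: "z = heis_cochain a b c d e f"
      using heis_Z2_cases[OF assms mem] by blast
    have "b = (- d $ 2) *s hz" "c = (d $ 1) *s hz"
      "e $ 1 = 0" "e $ 2 = 0" "f $ 1 = 0" "f $ 2 = 0"
      using mem unfolding z by (auto simp: simps vec_eq_iff forall_3)
    then show ?thesis
      unfolding comb z
      \<comment> \<open>After subtraction the first slot has first two coordinates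
        \<open>d $ 1\<close> and \<open>d $ 2\<close>, as the coboundary with \<open>s = d\<close>
        requires.\<close>
      by (intro exI[of _ "(!) [a $ 1 - d $ 1, a $ 2 - d $ 2, e $ 3, f $ 3]"])
        (auto simp: simps vec_eq_iff forall_3 intro!: exI[of _ d])
  qed
  show "H2_dim = 4" "H2_basis (H2_class `
      {(heis_alt hx 0 0, 0), (heis_alt hy 0 0, 0), (0, heis_semi 0 hz 0), (0, heis_semi 0 0 hz)})"
    using heis_H2_basis_list[OF assms cocycles indep spans] unfolding len list.set by simp_all
qed

text \<open>The argument for \<open>x_dual\<close> with \<open>f\<close> in the role of
  \<open>d\<close>: now \<open>\<theta> hz = 1\<close>, so \<open>f\<close> determines
  \<open>b\<close> and \<open>c\<close>, while \<open>d\<close> and \<open>e\<close> are multiples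
  of \<open>hz\<close>.\<close>

lemma heis_H2_z_dual:
  assumes "CHAR('a::field) > 3"
  shows "heis_H2_basis (z_dual :: 'a ^ 3 \<Rightarrow> 'a) (heis_H2_class z_dual `
      {(heis_alt hx 0 0, 0), (heis_alt hy 0 0, 0), (0, heis_semi 0 hz 0), (0, heis_semi hz 0 0)})"
    and "heis_H2_dim (z_dual :: 'a ^ 3 \<Rightarrow> 'a) = 4"
proof -
  interpret restricted_lie_algebra "(*s)" heis_bracket "heis_pmap (z_dual :: 'a ^ 3 \<Rightarrow> 'a)"
    by (rule heis_restricted_lie_algebra) fact
  let ?vs = "[(heis_alt hx 0 0, 0), (heis_alt hy 0 0, 0), (0, heis_semi 0 hz 0), (0, heis_semi hz 0 0)]
       :: (('a ^ 3 \<Rightarrow> 'a ^ 3 \<Rightarrow> 'a ^ 3) \<times> ('a ^ 3 \<Rightarrow> 'a ^ 3)) list"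
  have len: "length ?vs = 4" by simp
  note simps = heis_cochain_scale[OF assms] heis_cochain_in_Z2_iff[OF assms]
    heis_cochain_in_B2_iff[OF assms] heis_cochain_alt heis_cochain_semi
    heis_cochain_add heis_cochain_diff z_dual_def
  have comb: "(\<Sum>i<length ?vs. pair_scale (r i) (?vs ! i)) = heis_cochain
      (r 0 *s hx + r 1 *s hy) 0 0 (r 3 *s hz) (r 2 *s hz) 0" for r
    by (simp add: eval_nat_numeral simps algebra_simps)
  have cocycles: "set ?vs \<subseteq> Z2"
    by (simp add: simps)
  have indep: "\<forall>i<length ?vs. r i = 0"
    if "(\<Sum>i<length ?vs. pair_scale (r i) (?vs ! i)) \<in> B2" for r
    using that unfolding comb unfolding len all_lessThan_4
    by (auto simp: simps vec_eq_iff forall_3)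
  have spans: "\<exists>r. z - (\<Sum>i<length ?vs. pair_scale (r i) (?vs ! i)) \<in> B2" if mem: "z \<in> Z2" for z
  proof -
    obtain a b c d e f where z: "z = heis_cochain a b c d e f"
      using heis_Z2_cases[OF assms mem] by blast
    have "b = (- f $ 2) *s hz" "c = (f $ 1) *s hz"
      "d $ 1 = 0" "d $ 2 = 0" "e $ 1 = 0" "e $ 2 = 0"
      using mem unfolding z by (auto simp: simps vec_eq_iff forall_3)
    then show ?thesis
      unfolding comb z
      \<comment> \<open>The list has the class supported at \<open>y\<close> before the one at
        \<open>x\<close>, hence \<open>e $ 3\<close> precedes \<open>d $ 3\<close>.\<close>
      by (intro exI[of _ "(!) [a $ 1 - f $ 1, a $ 2 - f $ 2, e $ 3, d $ 3]"])
        (auto simp: simps vec_eq_iff forall_3 intro!: exI[of _ f])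
  qed
  show "H2_dim = 4" "H2_basis (H2_class `
      {(heis_alt hx 0 0, 0), (heis_alt hy 0 0, 0), (0, heis_semi 0 hz 0), (0, heis_semi hz 0 0)})"
    using heis_H2_basis_list[OF assms cocycles indep spans] unfolding len list.set by simp_all
qed

theorem theorem4p7:
  assumes "CHAR('a::field) > 3"
  shows "heis_H2_dim (0 :: 'a ^ 3 \<Rightarrow> 'a) = 8
    \<and> heis_H2_dim (x_dual :: 'a ^ 3 \<Rightarrow> 'a) = 4
    \<and> heis_H2_dim (z_dual :: 'a ^ 3 \<Rightarrow> 'a) = 4
    \<and> heis_H2_basis (0 :: 'a ^ 3 \<Rightarrow> 'a) (heis_H2_class 0 `
        {(heis_alt 0 hz 0, 0), (heis_alt 0 0 hz, 0), (heis_alt 0 hx (- hy), 0),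
         (heis_alt 0 hy 0, 0), (heis_alt 0 0 hx, 0),
         (0, heis_semi hz 0 0), (0, heis_semi 0 hz 0), (0, heis_semi 0 0 hz)})
    \<and> heis_H2_basis (x_dual :: 'a ^ 3 \<Rightarrow> 'a) (heis_H2_class x_dual `
        {(heis_alt hx 0 0, 0), (heis_alt hy 0 0, 0),
         (0, heis_semi 0 hz 0), (0, heis_semi 0 0 hz)})
    \<and> heis_H2_basis (z_dual :: 'a ^ 3 \<Rightarrow> 'a) (heis_H2_class z_dual `
        {(heis_alt hx 0 0, 0), (heis_alt hy 0 0, 0),
         (0, heis_semi 0 hz 0), (0, heis_semi hz 0 0)})"
  by (intro conjI heis_H2_zero[OF assms] heis_H2_x_dual[OF assms] heis_H2_z_dual[OF assms])

end
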